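(* Let $\mathbb{R}P^2_H$ and $\mathbb{R}P^2_E$ denote the real projective plane, with coordinates $(x=X/Z,\ y=Y/Z)$, equipped with the point–line duality inherited by projectivization from $\mathbb{R}^3_H$ and $\mathbb{R}^3_E$ respectively. Then: the point dual to a line in $\mathbb{R}P^2_E$ is symmetric, with respect to the point $(0,0)$, to the point dual to the same line in $\mathbb{R}P^2_H$; and the line dual to a point in $\mathbb{R}P^2_E$ is symmetric, with respect to the point $(0,0)$, to the line dual to the same point in $\mathbb{R}P^2_H$.
   Context: $\mathbb{R}^3_E$ is $\mathbb{R}^3$ with scalar product $XX'+YY'+ZZ'$; $\mathbb{R}^3_H$ is $\mathbb{R}^3$ with scalar product $XX'+YY'-ZZ'$. A point of the projective plane is a straight line through the origin of $\mathbb{R}^3$, and a line of the projective plane is (the projection of) a plane through the origin. In $\mathbb{R}P^2_E$ (respectively $\mathbb{R}P^2_H$) a point and a line are dual if the corresponding straight line through the origin and plane through the origin are orthogonal in $\mathbb{R}^3_E$ (respectively $\mathbb{R}^3_H$). The symmetry with respect to $(0,0)$ is the map $(x,y)\mapsto(-x,-y)$ in the affine chart, extended to the projective plane as $[X:Y:Z]\mapsto[-X:-Y:Z]$. *)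

theory Defs
  imports "HOL-Analysis.Analysis"
begin

definition scalar_E :: "real^3 \<Rightarrow> real^3 \<Rightarrow> real" where
  "scalar_E u v = u$1 * v$1 + u$2 * v$2 + u$3 * v$3"

definition scalar_H :: "real^3 \<Rightarrow> real^3 \<Rightarrow> real" where
  "scalar_H u v = u$1 * v$1 + u$2 * v$2 - u$3 * v$3"

lemma scalar_E_eq_inner: "scalar_E u v = u \<bullet> v"
  by (simp add: scalar_E_def inner_vec_def sum_3)

type_synonym proj_point = "(real^3) set"

definition proj_points :: "proj_point set" where
  "proj_points = {l. subspace l \<and> dim l = 1}"

definition planes :: "(real^3) set set" where
  "planes = {P. subspace P \<and> dim P = 2}"

text \<open>A projective line is kept distinct from its plane: it is the set of the projective
  points (straight lines through the origin) lying in that plane.\<close>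

definition projectivize :: "(real^3) set \<Rightarrow> proj_point set" where
  "projectivize P = {l \<in> proj_points. l \<subseteq> P}"

definition proj_lines :: "proj_point set set" where
  "proj_lines = projectivize ` planes"

definition dual :: "(real^3 \<Rightarrow> real^3 \<Rightarrow> real) \<Rightarrow> proj_point \<Rightarrow> proj_point set \<Rightarrow> bool" where
  "dual B l L \<longleftrightarrow>
     l \<in> proj_points \<and> (\<exists>P\<in>planes. L = projectivize P \<and> (\<forall>u\<in>l. \<forall>v\<in>P. B u v = 0))"

definition homog :: "real \<Rightarrow> real \<Rightarrow> real \<Rightarrow> proj_point" where
  "homog X Y Z = span {vector [X, Y, Z]}"

text \<open>The symmetry with respect to \<open>(0,0)\<close> acts on a projective point as below, and on a
  projective line \<open>L\<close> pointwise, as \<open>central_symmetry ` L\<close>.\<close>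

definition central_symmetry :: "proj_point \<Rightarrow> proj_point" where
  "central_symmetry l = (\<lambda>v. vector [- v$1, - v$2, v$3]) ` l"

lemma central_symmetry_homog: "central_symmetry (homog X Y Z) = homog (-X) (-Y) Z"
proof -
  have "linear (\<lambda>v::real^3. vector [- v$1, - v$2, v$3] :: real^3)"
    by (rule linearI) (simp_all add: vec_eq_iff forall_3)
  from linear_span_image[OF this, of "{vector [X, Y, Z]}"]
  show ?thesis by (simp add: central_symmetry_def homog_def)
qed

lemma homog_affine_chart:
  assumes "Z \<noteq> 0" shows "homog X Y Z = homog (X / Z) (Y / Z) 1"
proof -
  have "vector [X, Y, Z] = Z *\<^sub>R (vector [X / Z, Y / Z, 1] :: real^3)"
    using assms by (simp add: vec_eq_iff forall_3)
  then show ?thesis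
    using assms span_image_scale[of "{vector [X / Z, Y / Z, 1] :: real^3}" "\<lambda>_. Z"]
    by (simp add: homog_def)
qed

end

theory Submission
  imports Defs
begin

text \<open>
  The half turn \<open>\<sigma>(X, Y, Z) = (-X, -Y, Z)\<close> links the two scalar products: since
  \<open>\<langle>u, v\<rangle>\<^sub>H = -(\<sigma> u \<bullet> v)\<close>, orthogonality of \<open>u\<close> and \<open>v\<close> in
  the hyperbolic sense is Euclidean orthogonality of \<open>\<sigma> u\<close> and \<open>v\<close>. Hence a point
  \<open>q\<close> is hyperbolically dual to a line exactly when its symmetric image \<open>\<sigma> q\<close> is
  Euclidean dual to that line (\<open>dual_H_iff\<close>), and everything reduces to Euclidean duality.

  Euclidean duality is the bijection \<open>l \<mapsto> l\<^sup>\<bottom>\<close> between straight lines and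
  planes through the origin (\<open>dual_E_iff\<close>), and a plane is determined by the projective line
  that it gives (\<open>projectivize_inj\<close>), so duals exist and are unique. This gives the claim on points at
  once: the Euclidean dual \<open>p\<close> of \<open>L\<close> and the image \<open>\<sigma> q\<close> of its hyperbolic dual are both
  Euclidean dual to \<open>L\<close>. For lines one uses moreover that \<open>\<sigma>\<close> is an isometry, so
  that Euclidean duality commutes with it (\<open>dual_E_symmetric\<close>): the hyperbolic dual of \<open>p\<close>,
  being the Euclidean dual of \<open>\<sigma> p\<close>, is the image of the Euclidean dual of \<open>p\<close>.
\<close>

definition half_turn :: "real^3 \<Rightarrow> real^3" where
  "half_turn v = vector [- v$1, - v$2, v$3]"

lemma central_symmetry_eq_image: "central_symmetry l = half_turn ` l"
  by (simp add: central_symmetry_def half_turn_def)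

lemma half_turn_half_turn [simp]: "half_turn (half_turn v) = v"
  by (simp add: half_turn_def vec_eq_iff forall_3)

lemma linear_half_turn: "linear half_turn"
  by (rule linearI) (simp_all add: half_turn_def vec_eq_iff forall_3)

lemma inj_half_turn: "inj half_turn"
  by (metis half_turn_half_turn injI)

lemma half_turn_isometry: "scalar_E (half_turn u) (half_turn v) = scalar_E u v"
  by (simp add: scalar_E_def half_turn_def)

lemma scalar_H_eq_half_turn: "scalar_H u v = - scalar_E (half_turn u) v"
  by (simp add: scalar_H_def scalar_E_def half_turn_def)

lemma half_turn_image_image [simp]: "half_turn ` half_turn ` S = S"
  by (simp add: image_image)

lemma subspace_dim_half_turn_image:
  assumes "subspace S"
  shows "subspace (half_turn ` S)" and "dim (half_turn ` S) = dim S"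
  using assms linear_half_turn inj_half_turn
  by (auto intro: linear_subspace_image dim_image_eq inj_on_subset)

lemma central_symmetry_idem [simp]: "central_symmetry (central_symmetry l) = l"
  by (simp add: central_symmetry_eq_image)

lemma central_symmetry_in_proj_points_iff [simp]:
  "central_symmetry l \<in> proj_points \<longleftrightarrow> l \<in> proj_points"
proof -
  have "central_symmetry m \<in> proj_points" if "m \<in> proj_points" for m
    using that by (simp add: proj_points_def central_symmetry_eq_image subspace_dim_half_turn_image)
  from this[of l] this[of "central_symmetry l"] show ?thesis by auto
qed

lemma half_turn_image_planes: "P \<in> planes \<Longrightarrow> half_turn ` P \<in> planes"
  by (simp add: planes_def subspace_dim_half_turn_image)

lemma central_symmetry_image_projectivize:
  "central_symmetry ` projectivize P = projectivize (half_turn ` P)"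
proof -
  have sub: "central_symmetry ` projectivize Q \<subseteq> projectivize (half_turn ` Q)" for Q
    by (auto simp: projectivize_def) (auto simp: central_symmetry_eq_image)
  have "l \<in> central_symmetry ` projectivize P" if "l \<in> projectivize (half_turn ` P)" for l
  proof
    show "central_symmetry l \<in> projectivize P"
      using sub[of "half_turn ` P"] that by auto
  qed simp
  with sub show ?thesis by blast
qed

text \<open>A subspace is recovered from its projectivization: a nonzero vector lies in it exactly when
  the straight line that it spans does.\<close>

lemma projectivize_inj:
  assumes "subspace P" "subspace Q" "projectivize P = projectivize Q"
  shows "P = Q"
proof -
  have "v \<in> P \<longleftrightarrow> span {v} \<in> projectivize P" if "subspace P" "v \<noteq> 0" for v P
    using that by (auto simp: projectivize_def proj_points_def span_base
        intro: span_minimal[THEN subsetD])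
  with assms show ?thesis
    by (metis subsetI subset_antisym subspace_0)
qed

lemma dim_orthogonal_comp:
  fixes S :: "'a::euclidean_space set"
  assumes "subspace S"
  shows "dim (orthogonal_comp S) + dim S = DIM('a)"
  using dim_subspace_orthogonal_to_vectors[OF assms subspace_UNIV]
  by (simp add: orthogonal_comp_def)

lemma orthogonal_comp_proj_point: "l \<in> proj_points \<Longrightarrow> orthogonal_comp l \<in> planes"
  using dim_orthogonal_comp[of l]
  by (simp add: proj_points_def planes_def subspace_orthogonal_comp)

lemma orthogonal_comp_plane: "P \<in> planes \<Longrightarrow> orthogonal_comp P \<in> proj_points"
  using dim_orthogonal_comp[of P]
  by (simp add: proj_points_def planes_def subspace_orthogonal_comp)

text \<open>Duality only asks that the plane be contained in the orthogonal complement of the straight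
  line; having the same dimension, the two planes coincide.\<close>

lemma dual_E_iff:
  "dual scalar_E l L \<longleftrightarrow> l \<in> proj_points \<and> L = projectivize (orthogonal_comp l)"
proof -
  have orth: "(\<forall>u\<in>l. \<forall>v\<in>P. scalar_E u v = 0) \<longleftrightarrow> P \<subseteq> orthogonal_comp l" for P
    by (auto simp: scalar_E_eq_inner orthogonal_comp_def orthogonal_def)
  have "P = orthogonal_comp l"
    if "l \<in> proj_points" "P \<in> planes" "P \<subseteq> orthogonal_comp l" for P
    using that orthogonal_comp_proj_point[of l]
    by (intro subspace_dim_equal) (auto simp: planes_def)
  then show ?thesis
    unfolding dual_def orth using orthogonal_comp_proj_point by blast
qed

lemma ex1_dual_E_point:
  assumes "L \<in> proj_lines"
  shows "\<exists>!p. dual scalar_E p L"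
proof -
  obtain P where P: "P \<in> planes" "L = projectivize P"
    using assms by (auto simp: proj_lines_def)
  show ?thesis
  proof (rule ex1I)
    show "dual scalar_E (orthogonal_comp P) L"
      using P by (simp add: dual_E_iff orthogonal_comp_plane orthogonal_comp_self planes_def)
  next
    fix p assume "dual scalar_E p L"
    then have p: "p \<in> proj_points" "projectivize P = projectivize (orthogonal_comp p)"
      using P by (auto simp: dual_E_iff)
    then have "P = orthogonal_comp p"
      using P by (intro projectivize_inj) (auto simp: planes_def subspace_orthogonal_comp)
    with p show "p = orthogonal_comp P"
      by (simp add: proj_points_def orthogonal_comp_self)
  qed
qed

lemma ex1_dual_E_line: "p \<in> proj_points \<Longrightarrow> \<exists>!L. dual scalar_E p L"
  by (simp add: dual_E_iff)

text \<open>The sign by which \<open>scalar_H\<close> differs from \<open>scalar_E\<close> after the half turn disappears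
  because only the vanishing of the product matters.\<close>

lemma dual_H_iff: "dual scalar_H l L \<longleftrightarrow> dual scalar_E (central_symmetry l) L"
  unfolding dual_def by (simp add: scalar_H_eq_half_turn) (simp add: central_symmetry_eq_image)

lemma dual_E_symmetric:
  assumes "dual scalar_E l L"
  shows "dual scalar_E (central_symmetry l) (central_symmetry ` L)"
proof -
  obtain P where "l \<in> proj_points" "P \<in> planes" "L = projectivize P"
      and "\<forall>u\<in>l. \<forall>v\<in>P. scalar_E u v = 0"
    using assms by (auto simp: dual_def)
  moreover from this have "\<forall>u\<in>central_symmetry l. \<forall>v\<in>half_turn ` P. scalar_E u v = 0"
    by (simp add: central_symmetry_eq_image half_turn_isometry)
  ultimately show ?thesis
    unfolding dual_def
    by (auto simp: central_symmetry_image_projectivize intro: half_turn_image_planes)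
qed

theorem theorem3p1:
  shows "(\<forall>L\<in>proj_lines.
            (\<exists>!p. dual scalar_E p L) \<and> (\<exists>!q. dual scalar_H q L) \<and>
            (\<forall>p q. dual scalar_E p L \<and> dual scalar_H q L \<longrightarrow> p = central_symmetry q))
       \<and> (\<forall>p\<in>proj_points.
            (\<exists>!L. dual scalar_E p L) \<and> (\<exists>!M. dual scalar_H p M) \<and>
            (\<forall>L M. dual scalar_E p L \<and> dual scalar_H p M \<longrightarrow> L = central_symmetry ` M))"
proof (intro conjI ballI allI impI)
  fix L assume L: "L \<in> proj_lines"
  from ex1_dual_E_point[OF L] show "\<exists>!p. dual scalar_E p L" .
  then show "\<exists>!q. dual scalar_H q L"
    unfolding dual_H_iff by (metis central_symmetry_idem)
  fix p q assume "dual scalar_E p L \<and> dual scalar_H q L"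
  then show "p = central_symmetry q"
    using ex1_dual_E_point[OF L] by (auto simp: dual_H_iff)
next
  fix p assume p: "p \<in> proj_points"
  from ex1_dual_E_line[OF p] show "\<exists>!L. dual scalar_E p L" .
  from p show "\<exists>!M. dual scalar_H p M"
    unfolding dual_H_iff by (intro ex1_dual_E_line) simp
  fix L M assume "dual scalar_E p L \<and> dual scalar_H p M"
  then have "dual scalar_E p L" "dual scalar_E p (central_symmetry ` M)"
    using dual_E_symmetric[of "central_symmetry p" M] by (auto simp: dual_H_iff)
  with ex1_dual_E_line[OF p] show "L = central_symmetry ` M" by blast
qed

end
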